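(* Let $u_h$ be a numerical solution obtained by the finite volume method with the GRP numerical flux $f_\sigma^{GRP}$. Then, at each time level and for each face $\sigma=K|L\in\mathcal E_i$ and each $j\ne i$ with associated neighbouring face $\hat\sigma\in\mathcal E_j$, $\sigma\cap\hat\sigma\neq\emptyset$, $$\frac1{24}[[u_h]]_\sigma\le D_\sigma\le\frac1{12}\big|[[u_h]]_\sigma\big|+\frac78\max(|u_K|,|u_L|)+\frac{\Delta t}{2h}\max(u_K^2,u_L^2),\qquad |D_{\sigma,\hat\sigma}|\le\frac{\Delta t}{2h}\max(u_K^2,u_L^2).$$
   Context: **Mesh.** $d\in\{2,3\}$; the flat torus $\mathbb T^d$ is partitioned into a uniform mesh $\mathcal T_h$ of cubes (squares if $d=2$) $K$ of side $h$, with centers $x_K$, $|K|=h^d$. $\mathcal E$ is the set of faces, $\mathcal E_i$ the faces orthogonal to the basis vector $e_i$, $\mathcal E(K)$ and $\mathcal E_i(K)$ the corresponding faces of $K$; a face $\sigma$ has center $x_\sigma$ and $|\sigma|=h^{d-1}$; $n_K$ is the outer unit normal of $K$. $Q_h$ is the space of functions constant on each cell ($r_K$ is the value on $K$). For $\sigma=K|L\in\mathcal E_i$, with $L$ the neighbour of $K$ in direction $+e_i$, and a piecewise linear $v$: $v_\sigma^\pm=\lim_{\delta\to0+}v(x_\sigma\pm\delta e_i)$, $\{\{v\}\}_\sigma=(v_\sigma^++v_\sigma^-)/2$, $[[v]]_\sigma=v_\sigma^+-v_\sigma^-$ (so $[[r]]_\sigma=r_L-r_K$ for $r\in Q_h$).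 **Reconstruction (minmod).** For $r\in Q_h$, with $s_1,s_2$ the two numbers $[[r]]_\sigma/h$, $\sigma\in\mathcal E_i(K)$: $(\nabla_h^{(i)}r)_K=\min(s_1,s_2)$ if $s_1,s_2>0$, $=\max(s_1,s_2)$ if $s_1,s_2<0$, $=0$ otherwise. $R_Vr(x)=r_K+(x-x_K)\cdot(\nabla_hr)_K$ on $K$, and $\mathrm{div}_h(r)_K:=\sum_{j=1}^d(\nabla_h^{(j)}r)_K$. **Cases at $\sigma$ (with $r=R_Vu_h$).** Case 1: $[[r]]<0,\{\{r\}\}>0$. Case 2: $[[r]]<0,\{\{r\}\}\le0$. Case 3: $0<r_\sigma^-\le r_\sigma^+$. Case 4: $r_\sigma^-\le0\le r_\sigma^+$. Case 5: $r_\sigma^-\le r_\sigma^+<0$. **GRP flux and method** (Burgers, $f(u)=u^2/2$). $f_\sigma^{GRP}=\frac12|(R_Vu_h)_\sigma^-|^2(1-\Delta t(\mathrm{div}_hu_h)_\sigma^-)$ in Cases 1, 3; $\frac12|(R_Vu_h)_\sigma^+|^2(1-\Delta t(\mathrm{div}_hu_h)_\sigma^+)$ in Cases 2, 5; $0$ in Case 4. The method is $\frac{u_K(t+\Delta t)-u_K(t)}{\Delta t}+\sum_{\sigma\in\mathcal E(K)}\frac{|\sigma|}{|K|}f_\sigma^{GRP}\,(1,\dots,1)^T\cdot n_K=0$, with time step $\Delta t>0$ and $u_h(t,\cdot)\in Q_h$. **The factors.** All at a face $\sigma\in\mathcal E_i$. - For $[[r]]_\sigma\ne0$: $D_\sigma^{RP}(r)=\frac{6\{\{r\}\}-[[r]]}{12}$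 in Cases 1, 3; $-\frac{6\{\{r\}\}+[[r]]}{12}$ in Cases 2, 5; $\frac{12\{\{r\}\}^2+[[r]]^2}{24[[r]]}$ in Case 4. - $D_\sigma^{(1)}=\frac1{24}[[u_h]]$ if $[[R_Vu_h]]=0$; otherwise, with $\lambda=[[R_Vu_h]]/[[u_h]]$, $D_\sigma^{(1)}=\lambda D_\sigma^{RP}(R_Vu_h)+\frac{\{\{u_h\}\}^2-\{\{R_Vu_h\}\}^2}{2[[u_h]]}+\frac{1-\lambda^2}{24}[[u_h]]$. - $D_\sigma^{(2)}$ is defined by $D_\sigma^{(2)}[[u_h]]_\sigma=\frac{\Delta t}{2h}\,|(R_Vu_h)_\sigma^\mp|^2\,(h\nabla_h^{(i)}u_h)_\sigma^\mp$, with upper sign ($-$) in Cases 1, 3, lower sign ($+$) in Cases 2, 5, and right side $0$ in Case 4 ($D_\sigma^{(2)}=0$ if $[[u_h]]_\sigma=0$). - $D_\sigma=D_\sigma^{(1)}+D_\sigma^{(2)}$. - For $j\neq i$, let $\hat\sigma\in\mathcal E_j$ be a (fixed) face, orthogonal to $e_j$, of the cell on the side of $\sigma$ selected by the case (the $-$ side in Cases 1, 3, the $+$ side in Cases 2, 5), so $\sigma\cap\hat\sigma\ne\emptyset$. $D_{\sigma,\hat\sigma}$ is defined by $D_{\sigma,\hat\sigma}[[u_h]]_{\hat\sigma}=\frac{\Delta t}{2h}|(R_Vu_h)_\sigma^\mp|^2(h\nabla_h^{(j)}u_h)_\sigma^\mp$ with the same sign rule, and $0$ in Case 4 ($D_{\sigma,\hat\sigma}=0$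 if $[[u_h]]_{\hat\sigma}=0$). With $f_\sigma^{EC}(u_h)=\frac12\{\{u_h\}\}^2+\frac1{24}[[u_h]]^2$, these satisfy $f_\sigma^{EC}(u_h)-f_\sigma^{GRP}=D_\sigma[[u_h]]_\sigma+\sum_{j\ne i}D_{\sigma,\hat\sigma}[[u_h]]_{\hat\sigma}$. *)

theory Defs
  imports "HOL-Analysis.Analysis"
begin

text \<open>
  The torus is the quotient of \<open>real^'n\<close> by the lattice of periods \<open>N * h\<close> in every coordinate
  direction. Functions on it are represented by their periodic lifts to \<open>real^'n\<close>, and cells and
  faces by lifts as well: the cell with index \<open>k :: int^'n\<close> is the cube with lower corner
  \<open>h * k\<close>, and the pair \<open>(k, i)\<close> stands for the face between the cells \<open>k\<close> and \<open>k + axis i 1\<close>.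
\<close>

type_synonym 'n face = "(int^'n) \<times> 'n"

definition cell :: "real \<Rightarrow> int^'n \<Rightarrow> (real^'n) set" where
  "cell h k = {x. \<forall>i. h * of_int (k $ i) < x $ i \<and> x $ i < h * (of_int (k $ i) + 1)}"

definition cell_center :: "real \<Rightarrow> int^'n \<Rightarrow> real^'n" where
  "cell_center h k = (\<chi> i. h * (of_int (k $ i) + 1 / 2))"

definition cell_at :: "real \<Rightarrow> real^'n \<Rightarrow> int^'n" where
  "cell_at h x = (\<chi> i. \<lfloor>x $ i / h\<rfloor>)"

definition face_center :: "real \<Rightarrow> 'n face \<Rightarrow> real^'n" where
  "face_center h \<sigma> = cell_center h (fst \<sigma>) + (h / 2) *\<^sub>R axis (snd \<sigma>) 1"

definition cell_faces_dir :: "int^'n \<Rightarrow> 'n \<Rightarrow> ('n face) set" where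
  "cell_faces_dir k i = {(k - axis i 1, i), (k, i)}"

definition cell_faces :: "int^'n \<Rightarrow> ('n face) set" where
  "cell_faces k = (\<Union>i. cell_faces_dir k i)"

text \<open>Only meaningful for \<open>\<sigma> \<in> cell_faces k\<close>.\<close>

definition outer_normal :: "int^'n \<Rightarrow> 'n face \<Rightarrow> real^'n" where
  "outer_normal k \<sigma> = (if fst \<sigma> = k then axis (snd \<sigma>) 1 else - axis (snd \<sigma>) 1)"

text \<open>
  Piecewise constant functions on the torus; as cells are open, the values on the
  (null) skeleton of the mesh are left unconstrained.
\<close>

definition Qh :: "nat \<Rightarrow> real \<Rightarrow> (real^'n \<Rightarrow> real) set" where
  "Qh N h = {r. (\<forall>x i. r (x + (real N * h) *\<^sub>R axis i 1) = r x) \<and>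
                (\<forall>k. r constant_on cell h k)}"

definition cell_val :: "real \<Rightarrow> (real^'n \<Rightarrow> real) \<Rightarrow> int^'n \<Rightarrow> real" where
  "cell_val h r k = r (cell_center h k)"

definition piecewise_const :: "real \<Rightarrow> (int^'n \<Rightarrow> real) \<Rightarrow> real^'n \<Rightarrow> real" where
  "piecewise_const h a x = a (cell_at h x)"

datatype side = Minus | Plus

primrec side_sign :: "side \<Rightarrow> real" where
  "side_sign Minus = - 1"
| "side_sign Plus = 1"

definition face_trace :: "real \<Rightarrow> side \<Rightarrow> (real^'n \<Rightarrow> real) \<Rightarrow> 'n face \<Rightarrow> real" where
  "face_trace h s v \<sigma> =
     Lim (at_right 0) (\<lambda>\<delta>. v (face_center h \<sigma> + (side_sign s * \<delta>) *\<^sub>R axis (snd \<sigma>) 1))"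

definition avg :: "real \<Rightarrow> (real^'n \<Rightarrow> real) \<Rightarrow> 'n face \<Rightarrow> real" where
  "avg h v \<sigma> = (face_trace h Plus v \<sigma> + face_trace h Minus v \<sigma>) / 2"

definition jump :: "real \<Rightarrow> (real^'n \<Rightarrow> real) \<Rightarrow> 'n face \<Rightarrow> real" where
  "jump h v \<sigma> = face_trace h Plus v \<sigma> - face_trace h Minus v \<sigma>"

definition minmod :: "real \<Rightarrow> real \<Rightarrow> real" where
  "minmod s\<^sub>1 s\<^sub>2 =
     (if s\<^sub>1 > 0 \<and> s\<^sub>2 > 0 then min s\<^sub>1 s\<^sub>2
      else if s\<^sub>1 < 0 \<and> s\<^sub>2 < 0 then max s\<^sub>1 s\<^sub>2 else 0)"

definition nabla :: "real \<Rightarrow> (real^'n \<Rightarrow> real) \<Rightarrow> int^'n \<Rightarrow> real^'n" where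
  "nabla h r k = (\<chi> i. minmod (jump h r (k - axis i 1, i) / h) (jump h r (k, i) / h))"

definition recon :: "real \<Rightarrow> (real^'n \<Rightarrow> real) \<Rightarrow> real^'n \<Rightarrow> real" where
  "recon h r x = (let k = cell_at h x in cell_val h r k + (x - cell_center h k) \<bullet> nabla h r k)"

definition divh :: "real \<Rightarrow> (real^'n \<Rightarrow> real) \<Rightarrow> int^'n \<Rightarrow> real" where
  "divh h r k = (\<Sum>j\<in>UNIV. nabla h r k $ j)"

text \<open>The five cases refer to a piecewise linear \<open>r\<close>, typically \<open>recon h u\<close>.\<close>

definition case1 :: "real \<Rightarrow> (real^'n \<Rightarrow> real) \<Rightarrow> 'n face \<Rightarrow> bool" where
  "case1 h r \<sigma> \<longleftrightarrow> jump h r \<sigma> < 0 \<and> avg h r \<sigma> > 0"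

definition case2 :: "real \<Rightarrow> (real^'n \<Rightarrow> real) \<Rightarrow> 'n face \<Rightarrow> bool" where
  "case2 h r \<sigma> \<longleftrightarrow> jump h r \<sigma> < 0 \<and> avg h r \<sigma> \<le> 0"

definition case3 :: "real \<Rightarrow> (real^'n \<Rightarrow> real) \<Rightarrow> 'n face \<Rightarrow> bool" where
  "case3 h r \<sigma> \<longleftrightarrow> 0 < face_trace h Minus r \<sigma> \<and> face_trace h Minus r \<sigma> \<le> face_trace h Plus r \<sigma>"

definition case5 :: "real \<Rightarrow> (real^'n \<Rightarrow> real) \<Rightarrow> 'n face \<Rightarrow> bool" where
  "case5 h r \<sigma> \<longleftrightarrow> face_trace h Minus r \<sigma> \<le> face_trace h Plus r \<sigma> \<and> face_trace h Plus r \<sigma> < 0"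

text \<open>\<open>None\<close> is Case 4, see the lemma below.\<close>

definition upwind_side :: "real \<Rightarrow> (real^'n \<Rightarrow> real) \<Rightarrow> 'n face \<Rightarrow> side option" where
  "upwind_side h r \<sigma> =
     (if case1 h r \<sigma> \<or> case3 h r \<sigma> then Some Minus
      else if case2 h r \<sigma> \<or> case5 h r \<sigma> then Some Plus
      else None)"

lemma upwind_side_None_iff:
  "upwind_side h r \<sigma> = None \<longleftrightarrow> face_trace h Minus r \<sigma> \<le> 0 \<and> 0 \<le> face_trace h Plus r \<sigma>"
  by (auto simp: upwind_side_def case1_def case2_def case3_def case5_def jump_def avg_def)

definition side_cell :: "side \<Rightarrow> 'n face \<Rightarrow> int^'n" where
  "side_cell s \<sigma> = (case s of Minus \<Rightarrow> fst \<sigma> | Plus \<Rightarrow> fst \<sigma> + axis (snd \<sigma>) 1)"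

definition grp_flux :: "real \<Rightarrow> real \<Rightarrow> (real^'n \<Rightarrow> real) \<Rightarrow> 'n face \<Rightarrow> real" where
  "grp_flux dt h u \<sigma> =
     (case upwind_side h (recon h u) \<sigma> of
        Some s \<Rightarrow> 1 / 2 * \<bar>face_trace h s (recon h u) \<sigma>\<bar>\<^sup>2
                   * (1 - dt * face_trace h s (piecewise_const h (divh h u)) \<sigma>)
      | None \<Rightarrow> 0)"

text \<open>
  \<open>u m\<close> is the numerical solution at the time level \<open>m * dt\<close>. The factors \<open>h ^ (CARD('n) - 1)\<close>
  and \<open>h ^ CARD('n)\<close> are the measures of a face and of a cell.
\<close>

definition grp_solution :: "nat \<Rightarrow> real \<Rightarrow> real \<Rightarrow> (nat \<Rightarrow> real^'n \<Rightarrow> real) \<Rightarrow> bool" where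
  "grp_solution N h dt u \<longleftrightarrow>
     (\<forall>m. u m \<in> Qh N h) \<and>
     (\<forall>m k. (cell_val h (u (Suc m)) k - cell_val h (u m) k) / dt
        + (\<Sum>\<sigma>\<in>cell_faces k. h ^ (CARD('n) - 1) / h ^ CARD('n) * grp_flux dt h (u m) \<sigma>
                                * ((\<chi> _. 1) \<bullet> outer_normal k \<sigma>)) = 0)"

text \<open>Used only where \<open>jump h r \<sigma> \<noteq> 0\<close>.\<close>

definition D_RP :: "real \<Rightarrow> (real^'n \<Rightarrow> real) \<Rightarrow> 'n face \<Rightarrow> real" where
  "D_RP h r \<sigma> =
     (case upwind_side h r \<sigma> of
        Some Minus \<Rightarrow> (6 * avg h r \<sigma> - jump h r \<sigma>) / 12
      | Some Plus \<Rightarrow> - (6 * avg h r \<sigma> + jump h r \<sigma>) / 12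
      | None \<Rightarrow> (12 * (avg h r \<sigma>)\<^sup>2 + (jump h r \<sigma>)\<^sup>2) / (24 * jump h r \<sigma>))"

text \<open>
  In the last branch \<open>jump h u \<sigma> \<noteq> 0\<close>: for \<open>u \<in> Qh N h\<close> with \<open>jump h u \<sigma> = 0\<close> the limited slopes
  on both sides of \<open>\<sigma>\<close> vanish, so \<open>jump h (recon h u) \<sigma> = 0\<close> as well.
\<close>

definition D1 :: "real \<Rightarrow> (real^'n \<Rightarrow> real) \<Rightarrow> 'n face \<Rightarrow> real" where
  "D1 h u \<sigma> =
     (if jump h (recon h u) \<sigma> = 0 then 1 / 24 * jump h u \<sigma>
      else (let lam = jump h (recon h u) \<sigma> / jump h u \<sigma>
            in lam * D_RP h (recon h u) \<sigma>
               + ((avg h u \<sigma>)\<^sup>2 - (avg h (recon h u) \<sigma>)\<^sup>2) / (2 * jump h u \<sigma>)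
               + (1 - lam\<^sup>2) / 24 * jump h u \<sigma>))"

text \<open>
  The right-hand side in the defining relations of \<open>D2\<close> (direction \<open>j = snd \<sigma>\<close>) and of
  \<open>D_cross\<close> (direction \<open>j \<noteq> snd \<sigma>\<close>).
\<close>

definition D2_rhs :: "real \<Rightarrow> real \<Rightarrow> (real^'n \<Rightarrow> real) \<Rightarrow> 'n face \<Rightarrow> 'n \<Rightarrow> real" where
  "D2_rhs dt h u \<sigma> j =
     (case upwind_side h (recon h u) \<sigma> of
        Some s \<Rightarrow> dt / (2 * h) * \<bar>face_trace h s (recon h u) \<sigma>\<bar>\<^sup>2
                   * face_trace h s (piecewise_const h (\<lambda>k. h * nabla h u k $ j)) \<sigma>
      | None \<Rightarrow> 0)"

definition D2 :: "real \<Rightarrow> real \<Rightarrow> (real^'n \<Rightarrow> real) \<Rightarrow> 'n face \<Rightarrow> real" where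
  "D2 dt h u \<sigma> = (if jump h u \<sigma> = 0 then 0 else D2_rhs dt h u \<sigma> (snd \<sigma>) / jump h u \<sigma>)"

definition D_face :: "real \<Rightarrow> real \<Rightarrow> (real^'n \<Rightarrow> real) \<Rightarrow> 'n face \<Rightarrow> real" where
  "D_face dt h u \<sigma> = D1 h u \<sigma> + D2 dt h u \<sigma>"

text \<open>
  The admissible choices of the neighbouring face orthogonal to \<open>j\<close>. No side is selected
  in Case 4; there the faces of both cells adjacent to \<open>\<sigma>\<close> are admitted.
\<close>

definition hat_faces :: "real \<Rightarrow> (real^'n \<Rightarrow> real) \<Rightarrow> 'n face \<Rightarrow> 'n \<Rightarrow> ('n face) set" where
  "hat_faces h u \<sigma> j =
     (case upwind_side h (recon h u) \<sigma> of
        Some s \<Rightarrow> cell_faces_dir (side_cell s \<sigma>) j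
      | None \<Rightarrow> cell_faces_dir (side_cell Minus \<sigma>) j \<union> cell_faces_dir (side_cell Plus \<sigma>) j)"

definition D_cross :: "real \<Rightarrow> real \<Rightarrow> (real^'n \<Rightarrow> real) \<Rightarrow> 'n face \<Rightarrow> 'n face \<Rightarrow> real" where
  "D_cross dt h u \<sigma> \<sigma>' =
     (if jump h u \<sigma>' = 0 then 0 else D2_rhs dt h u \<sigma> (snd \<sigma>') / jump h u \<sigma>')"

end

(*
  Write J = jump u and A = avg u at the face. The minmod slopes on K and L are fractions
  alpha, beta in [0,1] of J/h, so the reconstructed traces u_K + alpha J/2 and u_L - beta J/2 lie
  between u_K and u_L. With w the upwind trace (0 in Case 4), the definition of the first factor
  collapses to D1 = J/24 + (A^2 - w^2)/(2J). On the minus side the quotient is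
  (1 - alpha)(A + w)/4, nonnegative by the case condition and at most M/2 with
  M = max(|u_K|, |u_L|); the plus side is its mirror image under (u_K, u_L) -> (-u_L, -u_K).
  In Case 4, zero lies between the traces, so |A| <= |J|/2 and the quotient is at most M/4.
  The remaining terms are dt/(2h) w^2 times a minmod fraction.
*)
theory Submission
  imports Defs
begin

section \<open>Face traces of piecewise constant and of reconstructed functions\<close>

lemma cell_center_in_cell: "h > 0 \<Longrightarrow> cell_center h k \<in> cell h k"
  by (simp add: cell_def cell_center_def)

lemma cell_at_eq: "h > 0 \<Longrightarrow> x \<in> cell h k \<Longrightarrow> cell_at h x = k"
  by (auto simp: cell_def cell_at_def vec_eq_iff floor_eq_iff field_simps less_imp_le)

lemma side_point_in_cell:
  assumes "0 < \<delta>" "\<delta> < h"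
  shows "face_center h \<sigma> + (side_sign s * \<delta>) *\<^sub>R axis (snd \<sigma>) 1 \<in> cell h (side_cell s \<sigma>)"
  using assms
  by (cases s) (auto simp: cell_def face_center_def cell_center_def side_cell_def axis_def field_simps)

text \<open>For small positive \<delta> the points defining the trace lie in the open cell on side
  \<open>s\<close>. There \<open>v\<close> agrees with a function continuous at the face centre, so
  the limit is a point value. This covers cell constants and affine reconstructions alike.\<close>

lemma face_trace_eqI:
  assumes "h > 0" and "\<And>x. x \<in> cell h (side_cell s \<sigma>) \<Longrightarrow> v x = g x"
    and "isCont g (face_center h \<sigma>)"
  shows "face_trace h s v \<sigma> = g (face_center h \<sigma>)"
proof -
  let ?x = "\<lambda>\<delta>. face_center h \<sigma> + (side_sign s * \<delta>) *\<^sub>R axis (snd \<sigma>) 1"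
  have "((\<lambda>\<delta>. ?x \<delta>) \<longlongrightarrow> face_center h \<sigma> + (side_sign s * 0) *\<^sub>R axis (snd \<sigma>) 1) (at_right 0)"
    by (intro tendsto_intros)
  then have "((\<lambda>\<delta>. g (?x \<delta>)) \<longlongrightarrow> g (face_center h \<sigma>)) (at_right 0)"
    using isCont_tendsto_compose[OF assms(3)] by simp
  moreover have "\<forall>\<^sub>F \<delta> in at_right 0. g (?x \<delta>) = v (?x \<delta>)"
    unfolding eventually_at_right_field using assms(1,2) side_point_in_cell by (metis (full_types))
  ultimately have "((\<lambda>\<delta>. v (?x \<delta>)) \<longlongrightarrow> g (face_center h \<sigma>)) (at_right 0)"
    by (rule Lim_transform_eventually)
  then show ?thesis
    unfolding face_trace_def by (intro tendsto_Lim) auto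
qed

lemma Qh_cell_eq:
  assumes "h > 0" "v \<in> Qh N h" "x \<in> cell h k"
  shows "v x = cell_val h v k"
proof -
  obtain c where "\<And>y. y \<in> cell h k \<Longrightarrow> v y = c"
    using assms(2) unfolding Qh_def constant_on_def by blast
  with assms(3) cell_center_in_cell[OF assms(1), of k] show ?thesis by (simp add: cell_val_def)
qed

lemma face_trace_Qh:
  assumes "h > 0" "v \<in> Qh N h"
  shows "face_trace h s v \<sigma> = cell_val h v (side_cell s \<sigma>)"
  by (rule face_trace_eqI[OF assms(1) Qh_cell_eq[OF assms]]) auto

lemma face_trace_piecewise_const:
  assumes "h > 0"
  shows "face_trace h s (piecewise_const h a) \<sigma> = a (side_cell s \<sigma>)"
  by (rule face_trace_eqI[OF assms]) (auto simp: piecewise_const_def cell_at_eq assms)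

text \<open>\<open>side_sign s\<close> points from the face into the cell, so the way from the cell
  centre back to the face carries the opposite sign.\<close>

lemma face_center_minus_cell_center:
  "face_center h \<sigma> - cell_center h (side_cell s \<sigma>) = (- side_sign s * h / 2) *\<^sub>R axis (snd \<sigma>) 1"
  by (cases s)
    (auto simp: face_center_def cell_center_def side_cell_def axis_def vec_eq_iff algebra_simps)

lemma face_trace_recon:
  assumes "h > 0"
  shows "face_trace h s (recon h v) \<sigma>
    = cell_val h v (side_cell s \<sigma>) - side_sign s * (h * nabla h v (side_cell s \<sigma>) $ snd \<sigma>) / 2"
proof -
  let ?k = "side_cell s \<sigma>"
  have "face_trace h s (recon h v) \<sigma>
    = cell_val h v ?k + (face_center h \<sigma> - cell_center h ?k) \<bullet> nabla h v ?k"
    by (rule face_trace_eqI[OF assms]) (auto simp: recon_def Let_def cell_at_eq assms)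
  then show ?thesis
    unfolding face_center_minus_cell_center by (simp add: inner_axis' algebra_simps)
qed

section \<open>Minmod slopes as fractions of a face jump\<close>

lemma minmod_commute: "minmod x y = minmod y x"
  by (auto simp: minmod_def min_def max_def)

lemma minmod_fraction: "\<exists>\<alpha>. 0 \<le> \<alpha> \<and> \<alpha> \<le> 1 \<and> minmod x y = \<alpha> * y"
proof (cases "y = 0")
  case False
  then show ?thesis
    by (intro exI[of _ "minmod x y / y"]) (auto simp: minmod_def min_def max_def divide_simps)
qed (auto simp: minmod_def intro: exI[of _ 0])

text \<open>By symmetry of minmod, the jump at either of the two faces can serve as reference. Hence
  any choice of the neighbouring face works in the bound for \<open>D_cross\<close>.\<close>

lemma nabla_fraction:
  assumes "h > 0" "\<sigma> \<in> cell_faces_dir k j"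
  shows "\<exists>\<alpha>. 0 \<le> \<alpha> \<and> \<alpha> \<le> 1 \<and> h * nabla h v k $ j = \<alpha> * jump h v \<sigma>"
proof -
  obtain x where x: "nabla h v k $ j = minmod x (jump h v \<sigma> / h)"
    using assms(2) minmod_commute by (auto simp: nabla_def cell_faces_dir_def)
  obtain \<alpha> where "0 \<le> \<alpha>" "\<alpha> \<le> 1" "minmod x (jump h v \<sigma> / h) = \<alpha> * (jump h v \<sigma> / h)"
    using minmod_fraction by blast
  with x assms(1) show ?thesis by (intro exI[of _ \<alpha>]) simp
qed

lemma face_in_cell_faces_dir: "\<sigma> \<in> cell_faces_dir (side_cell s \<sigma>) (snd \<sigma>)"
  by (cases s; cases \<sigma>) (auto simp: cell_faces_dir_def side_cell_def)

text \<open>Multiplying \<open>D_RP\<close> by the reconstructed jump makes the reconstructed mean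
  and jump cancel against the other summands of \<open>D1\<close>; only \<open>w\<close> survives.
  The hypothesis on a vanishing reconstructed jump serves the branch where \<open>D1\<close> is
  \<open>J/24\<close> by definition and the quotient must be zero.\<close>

lemma D1_eq:
  assumes J: "jump h v \<sigma> \<noteq> 0"
    and R: "jump h (recon h v) \<sigma> = 0 \<Longrightarrow> avg h (recon h v) \<sigma> = avg h v \<sigma>"
    and w: "w = (case upwind_side h (recon h v) \<sigma> of
              Some s \<Rightarrow> face_trace h s (recon h v) \<sigma> | None \<Rightarrow> 0)"
  shows "D1 h v \<sigma> = jump h v \<sigma> / 24 + ((avg h v \<sigma>)\<^sup>2 - w\<^sup>2) / (2 * jump h v \<sigma>)"
proof (cases "jump h (recon h v) \<sigma> = 0")
  case True
  then have "face_trace h s (recon h v) \<sigma> = avg h (recon h v) \<sigma>" for s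
    by (cases s) (auto simp: jump_def avg_def)
  \<comment> \<open>In Case 4 the common trace is both nonpositive and nonnegative, so the value 0
    of \<open>w\<close> is the mean there too.\<close>
  then have "w = avg h (recon h v) \<sigma>"
    using w upwind_side_None_iff[of h "recon h v" \<sigma>] by (auto split: option.splits)
  with True R show ?thesis by (simp add: D1_def)
next
  case False
  define r where "r = recon h v"
  define Jr where "Jr = jump h r \<sigma>"
  define R where "R = avg h r \<sigma>"
  have tr: "face_trace h Plus r \<sigma> = R + Jr / 2" "face_trace h Minus r \<sigma> = R - Jr / 2"
    by (auto simp: R_def Jr_def avg_def jump_def field_simps)
  have Jr: "Jr \<noteq> 0" using False by (simp add: Jr_def r_def)
  \<comment> \<open>The entropy conservative flux of the two reconstructed traces minus the upwind
    flux \<open>w^2/2\<close> without time correction.\<close>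
  have RP: "Jr * D_RP h r \<sigma> = R\<^sup>2 / 2 + Jr\<^sup>2 / 24 - w\<^sup>2 / 2"
    using w Jr unfolding D_RP_def r_def[symmetric] R_def[symmetric] Jr_def[symmetric]
    by (auto split: option.splits side.splits simp: tr field_simps power2_eq_square)
  have "D1 h v \<sigma> = (Jr * D_RP h r \<sigma>) / jump h v \<sigma>
      + ((avg h v \<sigma>)\<^sup>2 - R\<^sup>2) / (2 * jump h v \<sigma>) + (1 - (Jr / jump h v \<sigma>)\<^sup>2) / 24 * jump h v \<sigma>"
    using Jr by (simp add: D1_def Let_def r_def[symmetric] R_def[symmetric] Jr_def[symmetric])
  also have "\<dots> = jump h v \<sigma> / 24 + ((avg h v \<sigma>)\<^sup>2 - w\<^sup>2) / (2 * jump h v \<sigma>)"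
    unfolding RP using J by (simp add: field_simps power2_eq_square)
  finally show ?thesis .
qed

section \<open>Scalar bounds for the quotient \<open>(A^2 - w^2)/(2J)\<close> in the three upwind
  situations\<close>

lemma upwind_minus_bounds:
  fixes a b \<alpha> \<beta> :: real
  defines "J \<equiv> b - a" and "A \<equiv> (a + b) / 2"
    and "w \<equiv> a + \<alpha> * (b - a) / 2" and "w' \<equiv> b - \<beta> * (b - a) / 2"
  assumes "J \<noteq> 0" and \<alpha>: "0 \<le> \<alpha>" "\<alpha> \<le> 1" and \<beta>: "0 \<le> \<beta>" "\<beta> \<le> 1"
    \<comment> \<open>Cases 1 and 3. The sum is allowed to vanish so that the mirror image includes
      the non-strict Case 2.\<close>
    and up: "w' < w \<and> 0 \<le> w + w' \<or> 0 < w \<and> w \<le> w'"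
  shows "0 \<le> (A\<^sup>2 - w\<^sup>2) / (2 * J)" and "(A\<^sup>2 - w\<^sup>2) / (2 * J) \<le> 7 / 8 * max \<bar>a\<bar> \<bar>b\<bar>"
proof -
  have wA: "w = A - (1 - \<alpha>) * J / 2" and wA': "w' = A + (1 - \<beta>) * J / 2"
    by (auto simp: w_def w'_def A_def J_def field_simps)
  have q: "(A\<^sup>2 - w\<^sup>2) / (2 * J) = (1 - \<alpha>) * (A + w) / 4"
    using \<open>J \<noteq> 0\<close> by (simp add: wA field_simps power2_eq_square)
  \<comment> \<open>For \<open>J > 0\<close> the order is \<open>w \<le> A \<le> w'\<close>, which
    leaves only \<open>0 < w \<le> A\<close>. For \<open>J < 0\<close> it is
    \<open>w' \<le> A \<le> w\<close>: either \<open>A + w \<ge> w' + w \<ge> 0\<close>, or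
    \<open>w \<le> w'\<close> collapses all three values and forces
    \<open>\<alpha> = 1\<close>.\<close>
  have "0 \<le> A + w \<or> \<alpha> = 1"
  proof (cases "J > 0")
    case True
    then have "0 \<le> (1 - \<alpha>) * J" "0 \<le> (1 - \<beta>) * J" using \<alpha> \<beta> by auto
    then show ?thesis using up wA wA' by argo
  next
    case False
    then have "J < 0" using \<open>J \<noteq> 0\<close> by simp
    then have "(1 - \<alpha>) * J \<le> 0" "(1 - \<beta>) * J \<le> 0" "(1 - \<alpha>) * J = 0 \<Longrightarrow> \<alpha> = 1"
      using \<alpha> \<beta> by (auto simp: mult_le_0_iff)
    then show ?thesis using up wA wA' by argo
  qed
  then show "0 \<le> (A\<^sup>2 - w\<^sup>2) / (2 * J)" using \<alpha> unfolding q by auto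
  have "w = (1 - \<alpha> / 2) * a + (\<alpha> / 2) * b" by (simp add: w_def field_simps)
  also have "\<bar>\<dots>\<bar> \<le> max \<bar>a\<bar> \<bar>b\<bar>"
    using \<alpha> convex_bound_le[of "\<bar>a\<bar>" "max \<bar>a\<bar> \<bar>b\<bar>" "\<bar>b\<bar>" "1 - \<alpha> / 2" "\<alpha> / 2"]
      abs_triangle_ineq[of "(1 - \<alpha> / 2) * a" "\<alpha> / 2 * b"]
    by (simp add: abs_mult)
  finally have "\<bar>w\<bar> \<le> max \<bar>a\<bar> \<bar>b\<bar>" .
  moreover have "\<bar>A\<bar> \<le> max \<bar>a\<bar> \<bar>b\<bar>"
    by (auto simp: A_def max_def abs_if field_simps)
  ultimately have "\<bar>A + w\<bar> \<le> 2 * max \<bar>a\<bar> \<bar>b\<bar>"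
    using abs_triangle_ineq[of A w] by linarith
  moreover have "(1 - \<alpha>) * (A + w) \<le> \<bar>A + w\<bar>"
    using \<alpha> mult_left_mono[OF abs_ge_self, of "1 - \<alpha>" "A + w"]
      mult_left_le_one_le[of "\<bar>A + w\<bar>" "1 - \<alpha>"] by simp
  \<comment> \<open>The estimates give half the maximum, which lies within the stated
    \<open>7/8\<close>.\<close>
  ultimately show "(A\<^sup>2 - w\<^sup>2) / (2 * J) \<le> 7 / 8 * max \<bar>a\<bar> \<bar>b\<bar>" unfolding q by linarith
qed

lemma upwind_plus_bounds:
  fixes a b \<alpha> \<beta> :: real
  defines "J \<equiv> b - a" and "A \<equiv> (a + b) / 2"
    and "w \<equiv> a + \<alpha> * (b - a) / 2" and "w' \<equiv> b - \<beta> * (b - a) / 2"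
  assumes "J \<noteq> 0" and "0 \<le> \<alpha>" "\<alpha> \<le> 1" and "0 \<le> \<beta>" "\<beta> \<le> 1"
    and up: "w' < w \<and> w + w' \<le> 0 \<or> w \<le> w' \<and> w' < 0"
  shows "0 \<le> (A\<^sup>2 - w'\<^sup>2) / (2 * J)" and "(A\<^sup>2 - w'\<^sup>2) / (2 * J) \<le> 7 / 8 * max \<bar>a\<bar> \<bar>b\<bar>"
proof -
  have eq: "(- b + - a) / 2 = - A" "- a - - b = J" "- b + \<beta> * J / 2 = - w'"
      "- a - \<alpha> * J / 2 = - w"
    by (auto simp: A_def J_def w_def w'_def field_simps)
  \<comment> \<open>The reflection keeps \<open>J\<close>, negates \<open>A\<close>, swaps \<alpha>
    with \<beta>, and puts \<open>- w'\<close>, \<open>- w\<close> in place of \<open>w\<close>,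
    \<open>w'\<close>; squares and the maximum do not change.\<close>
  note mirror = upwind_minus_bounds[where a = "- b" and b = "- a" and \<alpha> = \<beta> and \<beta> = \<alpha>,
      unfolded eq power2_minus abs_minus_cancel max.commute[of "\<bar>b\<bar>"]]
  have up': "- w < - w' \<and> 0 \<le> - w' + - w \<or> 0 < - w' \<and> - w' \<le> - w"
    using up by auto
  show "0 \<le> (A\<^sup>2 - w'\<^sup>2) / (2 * J)"
    by (rule mirror(1)[OF assms(5,8,9,6,7) up'])
  show "(A\<^sup>2 - w'\<^sup>2) / (2 * J) \<le> 7 / 8 * max \<bar>a\<bar> \<bar>b\<bar>"
    by (rule mirror(2)[OF assms(5,8,9,6,7) up'])
qed

lemma upwind_none_bounds:
  fixes a b \<alpha> \<beta> :: real
  defines "J \<equiv> b - a" and "A \<equiv> (a + b) / 2"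
  assumes "J \<noteq> 0" and \<alpha>: "0 \<le> \<alpha>" "\<alpha> \<le> 1" and \<beta>: "0 \<le> \<beta>" "\<beta> \<le> 1"
    and up: "a + \<alpha> * (b - a) / 2 \<le> 0" "0 \<le> b - \<beta> * (b - a) / 2"
  shows "0 \<le> A\<^sup>2 / (2 * J)" and "A\<^sup>2 / (2 * J) \<le> 7 / 8 * max \<bar>a\<bar> \<bar>b\<bar>"
proof -
  have up': "A \<le> (1 - \<alpha>) * J / 2" "- A \<le> (1 - \<beta>) * J / 2"
    using up by (auto simp: A_def J_def field_simps)
  have "0 \<le> A\<^sup>2 / (2 * J) \<and> A\<^sup>2 / (2 * J) \<le> 7 / 8 * max \<bar>a\<bar> \<bar>b\<bar>"
  proof (cases "J > 0")
    case True
    then have "(1 - \<alpha>) * J \<le> J" "(1 - \<beta>) * J \<le> J" using \<alpha> \<beta> by (auto simp: field_simps)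
    then have "\<bar>A\<bar> \<le> J / 2" using up' by linarith
    \<comment> \<open>Only one factor of the square is replaced, so that \<open>J\<close> cancels
      and \<open>\<bar>A\<bar> / 4\<close> remains.\<close>
    then have "A\<^sup>2 \<le> \<bar>A\<bar> * (J / 2)"
      by (metis abs_ge_zero abs_mult_self_eq mult_left_mono power2_eq_square)
    then have "A\<^sup>2 / (2 * J) \<le> \<bar>A\<bar> / 4" using True by (simp add: field_simps)
    moreover have "\<bar>A\<bar> \<le> max \<bar>a\<bar> \<bar>b\<bar>" unfolding A_def by (auto simp: max_def abs_if)
    ultimately show ?thesis using True by simp
  next
    case False
    then have "(1 - \<alpha>) * J \<le> 0" "(1 - \<beta>) * J \<le> 0" using \<alpha> \<beta> by (auto simp: mult_le_0_iff)
    \<comment> \<open>Limiting preserves the order of decreasing data: left trace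
      \<open>\<ge> A \<ge>\<close> right trace. Case 4 demands the reverse around 0.\<close>
    then have "A = 0" using up' by linarith
    then show ?thesis by simp
  qed
  then show "0 \<le> A\<^sup>2 / (2 * J)" "A\<^sup>2 / (2 * J) \<le> 7 / 8 * max \<bar>a\<bar> \<bar>b\<bar>" by auto
qed

section \<open>Bounds on the factors at a face of the mesh\<close>

lemma recon_traces:
  assumes "h > 0" "v \<in> Qh N h"
  obtains \<alpha> \<beta> where "0 \<le> \<alpha>" "\<alpha> \<le> 1" "0 \<le> \<beta>" "\<beta> \<le> 1"
    "face_trace h Minus (recon h v) \<sigma> = face_trace h Minus v \<sigma> + \<alpha> * jump h v \<sigma> / 2"
    "face_trace h Plus (recon h v) \<sigma> = face_trace h Plus v \<sigma> - \<beta> * jump h v \<sigma> / 2"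
proof -
  note fr = nabla_fraction[OF assms(1) face_in_cell_faces_dir, of v]
  obtain \<alpha> where "0 \<le> \<alpha>" "\<alpha> \<le> 1"
    "h * nabla h v (side_cell Minus \<sigma>) $ snd \<sigma> = \<alpha> * jump h v \<sigma>" using fr by metis
  moreover obtain \<beta> where "0 \<le> \<beta>" "\<beta> \<le> 1"
    "h * nabla h v (side_cell Plus \<sigma>) $ snd \<sigma> = \<beta> * jump h v \<sigma>" using fr by blast
  ultimately show ?thesis
    by (intro that[of \<alpha> \<beta>]) (simp_all add: face_trace_recon face_trace_Qh[OF assms] assms(1))
qed

lemma D1_bounds:
  assumes "h > 0" "v \<in> Qh N h"
  shows "1 / 24 * jump h v \<sigma> \<le> D1 h v \<sigma>"
    and "D1 h v \<sigma> \<le> 1 / 24 * jump h v \<sigma>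
      + 7 / 8 * max \<bar>face_trace h Minus v \<sigma>\<bar> \<bar>face_trace h Plus v \<sigma>\<bar>"
proof -
  define a b where "a = face_trace h Minus v \<sigma>" and "b = face_trace h Plus v \<sigma>"
  have J: "jump h v \<sigma> = b - a" and A: "avg h v \<sigma> = (a + b) / 2"
    by (simp_all add: a_def b_def jump_def avg_def)
  obtain \<alpha> \<beta> where \<alpha>: "0 \<le> \<alpha>" "\<alpha> \<le> 1" and \<beta>: "0 \<le> \<beta>" "\<beta> \<le> 1"
    and tr: "face_trace h Minus (recon h v) \<sigma> = a + \<alpha> * (b - a) / 2"
      "face_trace h Plus (recon h v) \<sigma> = b - \<beta> * (b - a) / 2"
    using recon_traces[OF assms, of \<sigma>] unfolding J a_def[symmetric] b_def[symmetric] by blast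
  have "1 / 24 * jump h v \<sigma> \<le> D1 h v \<sigma> \<and> D1 h v \<sigma> \<le> 1 / 24 * jump h v \<sigma> + 7 / 8 * max \<bar>a\<bar> \<bar>b\<bar>"
  proof (cases "b - a = 0")
    case True
    \<comment> \<open>Both slopes are fractions of the zero jump, which selects the default branch
      of \<open>D1\<close>.\<close>
    then have "jump h (recon h v) \<sigma> = 0" by (simp add: jump_def tr)
    then show ?thesis by (simp add: D1_def)
  next
    case False
    have R: "avg h (recon h v) \<sigma> = avg h v \<sigma>" if "jump h (recon h v) \<sigma> = 0"
    proof -
      \<comment> \<open>The reconstructed jump is \<open>(1 - (\<alpha> + \<beta>)/2) J\<close>. It
        vanishes only when both slopes are full, and then both traces are the midpoint of
        \<open>a\<close> and \<open>b\<close>.\<close>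
      have "(b - a) * (2 - (\<alpha> + \<beta>)) = 0"
        using that by (simp add: jump_def tr field_simps)
      then have "\<alpha> = 1" "\<beta> = 1" using False \<alpha> \<beta> by auto
      then show ?thesis by (simp add: avg_def tr a_def[symmetric] b_def[symmetric] field_simps)
    qed
    note bounds = upwind_minus_bounds[OF False \<alpha> \<beta>, folded tr]
      upwind_plus_bounds[OF False \<alpha> \<beta>, folded tr] upwind_none_bounds[OF False \<alpha> \<beta>, folded tr]
    show ?thesis
    proof (cases "upwind_side h (recon h v) \<sigma>")
      case None
      then show ?thesis
        using D1_eq[of h v \<sigma>, OF _ R refl] False bounds(5,6) upwind_side_None_iff[of h "recon h v" \<sigma>]
        by (simp add: J A)
    next
      case (Some s)
      show ?thesis
      proof (cases s)
        case Minus
        with Some have "case1 h (recon h v) \<sigma> \<or> case3 h (recon h v) \<sigma>"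
          by (auto simp: upwind_side_def split: if_splits)
        then show ?thesis
          using D1_eq[of h v \<sigma>, OF _ R refl] False bounds(1,2) Some Minus
          by (auto simp: J A case1_def case3_def jump_def[of h "recon h v"] avg_def[of h "recon h v"])
      next
        case Plus
        with Some have "case2 h (recon h v) \<sigma> \<or> case5 h (recon h v) \<sigma>"
          by (auto simp: upwind_side_def split: if_splits)
        then show ?thesis
          using D1_eq[of h v \<sigma>, OF _ R refl] False bounds(3,4) Some Plus
          by (auto simp: J A case2_def case5_def jump_def[of h "recon h v"] avg_def[of h "recon h v"])
      qed
    qed
  qed
  then show "1 / 24 * jump h v \<sigma> \<le> D1 h v \<sigma>" "D1 h v \<sigma> \<le> 1 / 24 * jump h v \<sigma>
      + 7 / 8 * max \<bar>face_trace h Minus v \<sigma>\<bar> \<bar>face_trace h Plus v \<sigma>\<bar>"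
    by (auto simp: a_def b_def)
qed

text \<open>Each trace is a convex combination of the two cell values, and the square is
  convex.\<close>

lemma face_trace_recon_square_le:
  assumes "h > 0" "v \<in> Qh N h"
  shows "(face_trace h s (recon h v) \<sigma>)\<^sup>2
    \<le> max ((face_trace h Minus v \<sigma>)\<^sup>2) ((face_trace h Plus v \<sigma>)\<^sup>2)"
proof -
  define a b where "a = face_trace h Minus v \<sigma>" and "b = face_trace h Plus v \<sigma>"
  have J: "jump h v \<sigma> = b - a" by (simp add: a_def b_def jump_def)
  obtain \<alpha> \<beta> where "0 \<le> \<alpha>" "\<alpha> \<le> 1" "0 \<le> \<beta>" "\<beta> \<le> 1"
    and tr: "face_trace h Minus (recon h v) \<sigma> = a + \<alpha> * (b - a) / 2"
      "face_trace h Plus (recon h v) \<sigma> = b - \<beta> * (b - a) / 2"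
    using recon_traces[OF assms, of \<sigma>] unfolding J a_def[symmetric] b_def[symmetric] by blast
  then obtain t where "0 \<le> t" "t \<le> 1" "face_trace h s (recon h v) \<sigma> = (1 - t) * a + t * b"
  proof (cases s)
    case Minus
    show ?thesis by (rule that[of "\<alpha> / 2"]) (use Minus tr \<open>0 \<le> \<alpha>\<close> \<open>\<alpha> \<le> 1\<close> in \<open>auto simp: field_simps\<close>)
  next
    case Plus
    show ?thesis by (rule that[of "1 - \<beta> / 2"]) (use Plus tr \<open>0 \<le> \<beta>\<close> \<open>\<beta> \<le> 1\<close> in \<open>auto simp: field_simps\<close>)
  qed
  moreover from this have "((1 - t) * a + t * b)\<^sup>2 \<le> (1 - t) * a\<^sup>2 + t * b\<^sup>2"
    using convex_onD[OF convex_power2, of t a b] by simp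
  moreover have "\<dots> \<le> max (a\<^sup>2) (b\<^sup>2)"
    using \<open>0 \<le> t\<close> \<open>t \<le> 1\<close> by (intro convex_bound_le) auto
  ultimately show ?thesis by (simp add: a_def b_def)
qed

text \<open>The slope is a fraction of the jump in the denominator, so one argument serves
  \<open>D2\<close> and \<open>D_cross\<close>. The sign matters as well: it keeps \<open>D2\<close>
  from spoiling the lower bound for \<open>D_face\<close>.\<close>

lemma D2_rhs_quotient_bounds:
  assumes "h > 0" "dt > 0" "v \<in> Qh N h" and \<sigma>': "\<sigma>' \<in> hat_faces h v \<sigma> j"
  shows "0 \<le> D2_rhs dt h v \<sigma> j / jump h v \<sigma>'"
    and "D2_rhs dt h v \<sigma> j / jump h v \<sigma>'
      \<le> dt / (2 * h) * max ((face_trace h Minus v \<sigma>)\<^sup>2) ((face_trace h Plus v \<sigma>)\<^sup>2)"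
proof -
  let ?M = "max ((face_trace h Minus v \<sigma>)\<^sup>2) ((face_trace h Plus v \<sigma>)\<^sup>2)"
  have M: "0 \<le> dt / (2 * h) * ?M" using assms by (simp add: le_max_iff_disj)
  have "0 \<le> D2_rhs dt h v \<sigma> j / jump h v \<sigma>' \<and> D2_rhs dt h v \<sigma> j / jump h v \<sigma>' \<le> dt / (2 * h) * ?M"
  proof (cases "upwind_side h (recon h v) \<sigma> = None \<or> jump h v \<sigma>' = 0")
    case True
    \<comment> \<open>A zero jump makes the quotient 0 by the convention for division by
      zero.\<close>
    then show ?thesis using M by (auto simp: D2_rhs_def)
  next
    case False
    then obtain s where s: "upwind_side h (recon h v) \<sigma> = Some s" by auto
    then have "\<sigma>' \<in> cell_faces_dir (side_cell s \<sigma>) j" using \<sigma>' by (simp add: hat_faces_def)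
    then obtain \<alpha> where \<alpha>: "0 \<le> \<alpha>" "\<alpha> \<le> 1"
      and n: "h * nabla h v (side_cell s \<sigma>) $ j = \<alpha> * jump h v \<sigma>'"
      using nabla_fraction[OF assms(1)] by blast
    let ?w = "face_trace h s (recon h v) \<sigma>"
    have "D2_rhs dt h v \<sigma> j / jump h v \<sigma>' = dt / (2 * h) * (?w\<^sup>2 * \<alpha>)"
      using False s assms(1) by (simp add: D2_rhs_def face_trace_piecewise_const n)
    moreover have "?w\<^sup>2 * \<alpha> \<le> ?M * 1"
      using \<alpha> face_trace_recon_square_le[OF assms(1,3)] by (intro mult_mono) (auto simp: le_max_iff_disj)
    ultimately show ?thesis
      using \<alpha> assms(1,2) by (simp add: mult_left_mono divide_right_mono)
  qed
  then show "0 \<le> D2_rhs dt h v \<sigma> j / jump h v \<sigma>'"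
    "D2_rhs dt h v \<sigma> j / jump h v \<sigma>' \<le> dt / (2 * h) * ?M" by auto
qed

lemma face_in_hat_faces: "\<sigma> \<in> hat_faces h v \<sigma> (snd \<sigma>)"
  by (auto simp: hat_faces_def face_in_cell_faces_dir split: option.splits)

lemma snd_hat_face: "\<sigma>' \<in> hat_faces h v \<sigma> j \<Longrightarrow> snd \<sigma>' = j"
  by (auto simp: hat_faces_def cell_faces_dir_def split: option.splits)

theorem lemma3p2:
  fixes N m :: nat and h dt :: real and u :: "nat \<Rightarrow> real^'n \<Rightarrow> real"
    and K L :: "int^'n" and i :: 'n
  assumes "CARD('n) \<in> {2, 3}" and "N > 0" and "h > 0" and "dt > 0"
    and "grp_solution N h dt u"
    and "L = K + axis i 1"
  shows "1 / 24 * jump h (u m) (K, i) \<le> D_face dt h (u m) (K, i) \<and>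
    D_face dt h (u m) (K, i)
      \<le> 1 / 12 * \<bar>jump h (u m) (K, i)\<bar>
        + 7 / 8 * max \<bar>cell_val h (u m) K\<bar> \<bar>cell_val h (u m) L\<bar>
        + dt / (2 * h) * max ((cell_val h (u m) K)\<^sup>2) ((cell_val h (u m) L)\<^sup>2) \<and>
    (\<forall>j \<sigma>'. j \<noteq> i \<longrightarrow> \<sigma>' \<in> hat_faces h (u m) (K, i) j \<longrightarrow>
      \<bar>D_cross dt h (u m) (K, i) \<sigma>'\<bar>
        \<le> dt / (2 * h) * max ((cell_val h (u m) K)\<^sup>2) ((cell_val h (u m) L)\<^sup>2))"
proof -
  have v: "u m \<in> Qh N h" using assms(5) by (simp add: grp_solution_def)
  have tr: "face_trace h Minus (u m) (K, i) = cell_val h (u m) K"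
    "face_trace h Plus (u m) (K, i) = cell_val h (u m) L"
    using assms(6) by (simp_all add: face_trace_Qh[OF assms(3) v] side_cell_def)
  note D1 = D1_bounds[OF assms(3) v, of "(K, i)", unfolded tr]
  note D2 = D2_rhs_quotient_bounds[OF assms(3,4) v, of _ "(K, i)", unfolded tr]
  have "0 \<le> D2 dt h (u m) (K, i) \<and> D2 dt h (u m) (K, i)
      \<le> dt / (2 * h) * max ((cell_val h (u m) K)\<^sup>2) ((cell_val h (u m) L)\<^sup>2)"
    \<comment> \<open>The diagonal instance: the face itself plays the part of its neighbour, in
      direction \<open>i\<close>.\<close>
    using D2[OF face_in_hat_faces] by (auto simp: D2_def)
  moreover have "\<bar>D_cross dt h (u m) (K, i) \<sigma>'\<bar>
        \<le> dt / (2 * h) * max ((cell_val h (u m) K)\<^sup>2) ((cell_val h (u m) L)\<^sup>2)"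
    if "\<sigma>' \<in> hat_faces h (u m) (K, i) j" for j \<sigma>'
    using D2[OF that] snd_hat_face[OF that] by (auto simp: D_cross_def)
  moreover have "1 / 24 * jump h (u m) (K, i) \<le> 1 / 12 * \<bar>jump h (u m) (K, i)\<bar>" by simp
  ultimately show ?thesis
    using D1 unfolding D_face_def by (intro conjI allI impI) (linarith | blast)+
qed

end
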